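(* Let $r\ge0$ and $k\ge0$ be integers and let $M = \begin{pmatrix} A & B \\ J & A^{\dagger}\end{pmatrix}$ be the $(2r+2)\times(2r+2)$ $0,1$-matrix defined in the context, with rows and columns indexed by $0,1,\ldots,2r+1$. Let $i\in\{0\}\cup\{r+1,r+2,\ldots,2r+1\}$ and $j\in\{0,1,\ldots,r\}\cup\{2r+1\}$; if $(i,j)=(0,2r+1)$, assume in addition that $k\ge1$. Then the $\mathbf{cd}$-index of the interval $[(i,0),(j,k+1)]$ in the level poset associated to $M$ is $$\sum_{w} r^{\text{number of }\mathbf d\text{'s in }w}\cdot w,$$ where $w$ ranges over all $\mathbf{cd}$-monomials of degree $k$.
   Context: Blocks (all $(r+1)\times(r+1)$, indexed by $0\le i,j\le r$): $A=(a_{i,j})$ with $a_{i,j}=1$ if $i=0$ and $0$ otherwise; $B=(b_{i,j})$ with $b_{i,j}=1$ if $0\le i-j\le 1$ and $0$ otherwise; $J$ is the all-ones matrix; $A^{\dagger}$ has $(A^{\dagger})_{i,j}=1$ if $j=r$ and $0$ otherwise. The level poset associated to a $0,1$-matrix $X=(x_{i,j})$ is the ranked poset on (index set) $\times\mathbb{Z}$ with cover relations $(i,s)\prec(j,s+1)$ iff $x_{i,j}=1$. For a graded poset $P$ with rank function $\rho$, minimal element $\hat0$ and maximal element $\hat1$, the $\mathbf{ab}$-index is the polynomial in the non-commutative variables $\mathbf a,\mathbf b$ $$\Psi(P)=\sum_{c}(\mathbf a-\mathbf b)^{\rho(x_0,x_1)-1}\,\mathbf b\,(\mathbf a-\mathbf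 b)^{\rho(x_1,x_2)-1}\,\mathbf b\cdots\mathbf b\,(\mathbf a-\mathbf b)^{\rho(x_m,x_{m+1})-1},$$ the sum being over all chains $c=\{\hat0=x_0<x_1<\cdots<x_m<x_{m+1}=\hat1\}$ ($m\ge0$), where $\rho(x,y)=\rho(y)-\rho(x)$. For Eulerian $P$ it is a polynomial in $\mathbf c=\mathbf a+\mathbf b$ and $\mathbf d=\mathbf a\mathbf b+\mathbf b\mathbf a$, called the $\mathbf{cd}$-index. A $\mathbf{cd}$-monomial is a word in $\mathbf c,\mathbf d$, with $\mathbf c$ of degree $1$ and $\mathbf d$ of degree $2$. Convention: $0^0=1$. *)

theory Defs
  imports
    "HOL-Library.Poly_Mapping"
    "Jordan_Normal_Form.Matrix"
begin

section \<open>Non-commutative polynomials\<close>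

text \<open>
  Words under concatenation form a monoid. It is written additively because
  \<^theory>\<open>HOL-Library.Poly_Mapping\<close> turns finitely supported functions on an
  additive monoid into its monoid ring. Polynomials with integer coefficients in
  non-commuting variables from \<open>'x\<close> are therefore the type \<open>'x ncpoly\<close>.
\<close>

datatype 'x free_monoid = Wd (letters: "'x list")

instantiation free_monoid :: (type) monoid_add
begin

definition "0 = Wd []"
definition "u + v = Wd (letters u @ letters v)"

instance
  by standard (simp_all add: zero_free_monoid_def plus_free_monoid_def)

end

type_synonym 'x ncpoly = "'x free_monoid \<Rightarrow>\<^sub>0 int"

definition ncmono :: "'x list \<Rightarrow> 'x ncpoly" where
  "ncmono w = Poly_Mapping.single (Wd w) 1"

definition ncsubst :: "('x \<Rightarrow> 'y ncpoly) \<Rightarrow> 'x ncpoly \<Rightarrow> 'y ncpoly" where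
  "ncsubst f p = (\<Sum>w\<in>Poly_Mapping.keys p.
     of_int (Poly_Mapping.lookup p w) * prod_list (map f (letters w)))"

datatype ab_letter = Let_a | Let_b

datatype cd_letter = Let_c | Let_d

abbreviation ab_a :: "ab_letter ncpoly" where "ab_a \<equiv> ncmono [Let_a]"
abbreviation ab_b :: "ab_letter ncpoly" where "ab_b \<equiv> ncmono [Let_b]"

fun cd_in_ab :: "cd_letter \<Rightarrow> ab_letter ncpoly" where
  "cd_in_ab Let_c = ab_a + ab_b"
| "cd_in_ab Let_d = ab_a * ab_b + ab_b * ab_a"

fun cd_letter_degree :: "cd_letter \<Rightarrow> nat" where
  "cd_letter_degree Let_c = 1"
| "cd_letter_degree Let_d = 2"

definition cd_degree :: "cd_letter list \<Rightarrow> nat" where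
  "cd_degree w = sum_list (map cd_letter_degree w)"

text \<open>The sums over all words of a given degree are genuine finite sums.\<close>

lemma finite_cd_degree: "finite {w. cd_degree w = k}"
proof (rule finite_subset)
  have "length w \<le> cd_degree w" for w
  proof (induction w)
    case (Cons x w)
    then show ?case by (cases x) (simp_all add: cd_degree_def)
  qed (simp add: cd_degree_def)
  then show "{w. cd_degree w = k} \<subseteq> {w. set w \<subseteq> {Let_c, Let_d} \<and> length w \<le> k}"
    using cd_letter.exhaust by auto
qed (rule finite_lists_length_le, simp)


section \<open>Graded posets, the \<open>ab\<close>-index and the \<open>cd\<close>-index\<close>

text \<open>
  A finite poset is given by its carrier and its (reflexive) order relation. The rank
  function need not vanish at the least element: only differences of ranks are used.
\<close>

definition covered_by :: "('p \<times> 'p) set \<Rightarrow> 'p \<Rightarrow> 'p \<Rightarrow> bool" where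
  "covered_by r x y \<longleftrightarrow> (x, y) \<in> r \<and> x \<noteq> y \<and>
     (\<forall>z. (x, z) \<in> r \<and> (z, y) \<in> r \<longrightarrow> z = x \<or> z = y)"

definition interval :: "('p \<times> 'p) set \<Rightarrow> 'p \<Rightarrow> 'p \<Rightarrow> 'p set" where
  "interval r x y = {z. (x, z) \<in> r \<and> (z, y) \<in> r}"

definition graded_poset ::
    "'p set \<Rightarrow> ('p \<times> 'p) set \<Rightarrow> ('p \<Rightarrow> int) \<Rightarrow> 'p \<Rightarrow> 'p \<Rightarrow> bool" where
  "graded_poset P r \<rho> bt tp \<longleftrightarrow>
     finite P \<and> partial_order_on P r \<and>
     bt \<in> P \<and> tp \<in> P \<and> (\<forall>x\<in>P. (bt, x) \<in> r \<and> (x, tp) \<in> r) \<and>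
     (\<forall>x y. covered_by r x y \<longrightarrow> \<rho> y = \<rho> x + 1)"

definition Eulerian_poset ::
    "'p set \<Rightarrow> ('p \<times> 'p) set \<Rightarrow> ('p \<Rightarrow> int) \<Rightarrow> 'p \<Rightarrow> 'p \<Rightarrow> bool" where
  "Eulerian_poset P r \<rho> bt tp \<longleftrightarrow>
     graded_poset P r \<rho> bt tp \<and>
     (\<forall>x y. (x, y) \<in> r \<and> x \<noteq> y \<longrightarrow>
        card {z \<in> interval r x y. even (\<rho> z)} = card {z \<in> interval r x y. odd (\<rho> z)})"

definition chains_between :: "('p \<times> 'p) set \<Rightarrow> 'p \<Rightarrow> 'p \<Rightarrow> 'p list set" where
  "chains_between r x y =
     {x # zs @ [y] |zs. sorted_wrt (\<lambda>u v. (u, v) \<in> r \<and> u \<noteq> v) (x # zs @ [y])}"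

fun chain_weight :: "('p \<Rightarrow> int) \<Rightarrow> 'p list \<Rightarrow> ab_letter ncpoly" where
  "chain_weight \<rho> [x, y] = (ab_a - ab_b) ^ nat (\<rho> y - \<rho> x - 1)"
| "chain_weight \<rho> (x # y # z # zs) =
     (ab_a - ab_b) ^ nat (\<rho> y - \<rho> x - 1) * ab_b * chain_weight \<rho> (y # z # zs)"

definition ab_index :: "('p \<times> 'p) set \<Rightarrow> ('p \<Rightarrow> int) \<Rightarrow> 'p \<Rightarrow> 'p \<Rightarrow> ab_letter ncpoly" where
  "ab_index r \<rho> bt tp = (\<Sum>c\<in>chains_between r bt tp. chain_weight \<rho> c)"

text \<open>
  \<open>\<Phi>\<close> is the \<open>cd\<close>-index of the Eulerian poset: substituting \<open>c = a + b\<close> and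
  \<open>d = ab + ba\<close> into \<open>\<Phi>\<close> gives the \<open>ab\<close>-index. By \<open>is_cd_index_unique\<close> below there is
  at most one such \<open>\<Phi>\<close>.
\<close>

definition is_cd_index ::
    "'p set \<Rightarrow> ('p \<times> 'p) set \<Rightarrow> ('p \<Rightarrow> int) \<Rightarrow> 'p \<Rightarrow> 'p \<Rightarrow> cd_letter ncpoly \<Rightarrow> bool" where
  "is_cd_index P r \<rho> bt tp \<Phi> \<longleftrightarrow>
     Eulerian_poset P r \<rho> bt tp \<and> ab_index r \<rho> bt tp = ncsubst cd_in_ab \<Phi>"

text \<open>
  The polynomials \<open>a + b\<close> and \<open>ab + ba\<close> are algebraically independent: the
  substitution \<open>c \<mapsto> b\<close>, \<open>d \<mapsto> ba\<close> sends a \<open>cd\<close>-word \<open>w\<close> to an \<open>ab\<close>-word that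
  occurs once in the expansion of \<open>w\<close> and otherwise only in expansions of
  lexicographically larger \<open>cd\<close>-words, where \<open>d\<close> is below \<open>c\<close>.
\<close>

lemma ncmono_mult: "ncmono u * ncmono v = ncmono (u @ v)"
  by (simp add: ncmono_def mult_single plus_free_monoid_def)

fun cd_expand :: "cd_letter list \<Rightarrow> ab_letter list list" where
  "cd_expand [] = [[]]"
| "cd_expand (Let_c # w) =
     map ((@) [Let_a]) (cd_expand w) @ map ((@) [Let_b]) (cd_expand w)"
| "cd_expand (Let_d # w) =
     map ((@) [Let_a, Let_b]) (cd_expand w) @ map ((@) [Let_b, Let_a]) (cd_expand w)"

fun cd_lead :: "cd_letter list \<Rightarrow> ab_letter list" where
  "cd_lead [] = []"
| "cd_lead (Let_c # w) = Let_b # cd_lead w"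
| "cd_lead (Let_d # w) = Let_b # Let_a # cd_lead w"

lemma ncmono_mult_sum_list:
  "ncmono u * sum_list (map ncmono us) = (\<Sum>v\<leftarrow>us. ncmono (u @ v))"
  by (induction us) (simp_all add: distrib_left ncmono_mult)

lemma prod_list_cd_in_ab:
  "prod_list (map cd_in_ab w) = sum_list (map ncmono (cd_expand w))"
proof (induction w rule: cd_expand.induct)
  case 1
  then show ?case by (simp add: ncmono_def zero_free_monoid_def[symmetric])
qed (simp_all add: distrib_right ncmono_mult ncmono_mult_sum_list o_def)

lemma lookup_sum_list_ncmono:
  "Poly_Mapping.lookup (sum_list (map ncmono us)) (Wd v) = int (count_list us v)"
  by (induction us) (auto simp: lookup_add ncmono_def lookup_single when_def)

lemma count_list_map_append:
  "count_list (map ((@) p) us) (p @ v) = count_list us v"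
  by (induction us) auto

lemma lead_in_expand:
  assumes "cd_lead w \<in> set (cd_expand w')" "w \<noteq> w'"
  shows "(w, w') \<in> lexord {(Let_d, Let_c)}"
  using assms
proof (induction w' arbitrary: w rule: cd_expand.induct)
  case 1
  then show ?case by (cases w rule: cd_lead.cases) auto
next
  case (2 w')
  then show ?case by (cases w rule: cd_lead.cases) auto
next
  case (3 w')
  then show ?case
  proof (cases w rule: cd_lead.cases)
    case (2 v)
    with 3 show ?thesis by (cases v rule: cd_lead.cases) auto
  qed auto
qed

lemma count_expand_lead: "count_list (cd_expand w) (cd_lead w) = 1"
proof (induction w rule: cd_expand.induct)
  case (2 w)
  have "count_list (map ((@) [Let_b]) (cd_expand w)) ([Let_b] @ cd_lead w) = 1"
    using 2 by (simp only: count_list_map_append)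
  then show ?case by (auto simp: count_list_0_iff)
next
  case (3 w)
  have "count_list (map ((@) [Let_b, Let_a]) (cd_expand w)) ([Let_b, Let_a] @ cd_lead w) = 1"
    using 3 by (simp only: count_list_map_append)
  then show ?case by (auto simp: count_list_0_iff)
qed simp

lemma lookup_ncsubst_cd:
  assumes "finite S" "Poly_Mapping.keys \<Phi> \<subseteq> S"
  shows "Poly_Mapping.lookup (ncsubst cd_in_ab \<Phi>) (Wd v) =
    (\<Sum>w\<in>S. Poly_Mapping.lookup \<Phi> w * int (count_list (cd_expand (letters w)) v))"
proof -
  have "Poly_Mapping.lookup (of_int c * p) x = c * Poly_Mapping.lookup p x"
    for c and p :: "ab_letter ncpoly" and x
  proof -
    have "of_int c * p = Poly_Mapping.map ((*) c) p"
      by (simp add: mult_map_scale_conv_mult flip: single_of_int)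
    then show ?thesis by (simp add: Poly_Mapping.map.rep_eq when_def)
  qed
  then have "Poly_Mapping.lookup (ncsubst cd_in_ab \<Phi>) (Wd v) =
    (\<Sum>w\<in>Poly_Mapping.keys \<Phi>.
       Poly_Mapping.lookup \<Phi> w * int (count_list (cd_expand (letters w)) v))"
    by (simp add: ncsubst_def lookup_sum prod_list_cd_in_ab lookup_sum_list_ncmono)
  also have "\<dots> = (\<Sum>w\<in>S.
       Poly_Mapping.lookup \<Phi> w * int (count_list (cd_expand (letters w)) v))"
    using assms by (intro sum.mono_neutral_left) (auto simp: in_keys_iff)
  finally show ?thesis .
qed

lemma is_cd_index_unique:
  assumes "is_cd_index P r \<rho> bt tp \<Phi>" "is_cd_index P r \<rho> bt tp \<Psi>"
  shows "\<Phi> = \<Psi>"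
proof (rule ccontr)
  assume neq: "\<Phi> \<noteq> \<Psi>"
  define S where "S = Poly_Mapping.keys \<Phi> \<union> Poly_Mapping.keys \<Psi>"
  define f where "f w = Poly_Mapping.lookup \<Phi> w - Poly_Mapping.lookup \<Psi> w" for w
  define D where "D = {w. f (Wd w) \<noteq> 0}"
  let ?R = "lexord {(Let_d, Let_c)}"
  have S: "finite S" "Poly_Mapping.keys \<Phi> \<subseteq> S" "Poly_Mapping.keys \<Psi> \<subseteq> S"
    by (auto simp: S_def)
  have zero: "(\<Sum>w\<in>S. f w * int (count_list (cd_expand (letters w)) v)) = 0" for v
    using assms lookup_ncsubst_cd[OF S(1,2), of v] lookup_ncsubst_cd[OF S(1,3), of v]
    by (simp add: is_cd_index_def f_def left_diff_distrib sum_subtractf)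
  have DS: "Wd ` D \<subseteq> S"
    by (auto simp: D_def f_def S_def in_keys_iff)
  have "finite D"
    using finite_subset[OF DS S(1)] by (rule finite_imageD) (simp add: inj_on_def)
  have "D \<noteq> {}"
  proof -
    obtain w where "f w \<noteq> 0"
      using neq by (auto simp: f_def intro: poly_mapping_eqI)
    then show ?thesis by (cases w) (auto simp: D_def)
  qed
  have "trans ?R" by (rule lexord_transI) (simp add: trans_def)
  moreover have "irrefl ?R" by (rule lexord_irrefl) (simp add: irrefl_def)
  ultimately have "acyclic (?R\<inverse>)"
    by (simp add: acyclic_irrefl)
  then have "wf (Restr (?R\<inverse>) D)"
    using \<open>finite D\<close> by (intro finite_acyclic_wf) (auto intro: acyclic_subset)
  moreover obtain w0 where "w0 \<in> D" using \<open>D \<noteq> {}\<close> by blast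
  ultimately obtain w
    where w: "w \<in> D" and "\<forall>w'. (w', w) \<in> Restr (?R\<inverse>) D \<longrightarrow> w' \<notin> D"
    by (metis wfE_min)
  then have mx: "(w, w') \<in> ?R \<Longrightarrow> w' \<notin> D" for w'
    using w by simp
  have "(\<Sum>w'\<in>S. f w' * int (count_list (cd_expand (letters w')) (cd_lead w)))
      = (\<Sum>w'\<in>{Wd w}. f w' * int (count_list (cd_expand (letters w')) (cd_lead w)))"
  proof (rule sum.mono_neutral_right[OF S(1)])
    show "{Wd w} \<subseteq> S" using w DS by blast
    show "\<forall>w'\<in>S - {Wd w}. f w' * int (count_list (cd_expand (letters w')) (cd_lead w)) = 0"
    proof
      fix w' assume "w' \<in> S - {Wd w}"
      then obtain u where u: "w' = Wd u" "w \<noteq> u" by (cases w') auto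
      show "f w' * int (count_list (cd_expand (letters w')) (cd_lead w)) = 0"
      proof (cases "cd_lead w \<in> set (cd_expand u)")
        case True
        then have "u \<notin> D" using lead_in_expand u mx by blast
        then show ?thesis by (simp add: D_def u)
      next
        case False
        then show ?thesis by (simp add: u)
      qed
    qed
  qed
  with zero[of "cd_lead w"] w show False
    by (simp add: count_expand_lead D_def)
qed

lemma finite_chains_between:
  assumes "graded_poset P r \<rho> bt tp"
  shows "finite (chains_between r bt tp)"
proof (rule finite_subset)
  have fin: "finite P" and po: "partial_order_on P r" and "bt \<in> P" "tp \<in> P"
    using assms by (auto simp: graded_poset_def)
  show "chains_between r bt tp \<subseteq> {xs. set xs \<subseteq> P \<and> length xs \<le> card P}"
  proof
    fix c assume "c \<in> chains_between r bt tp"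
    then obtain zs where c: "c = bt # zs @ [tp]"
      and s: "sorted_wrt (\<lambda>u v. (u, v) \<in> r \<and> u \<noteq> v) c"
      unfolding chains_between_def by blast
    from s c po have "set c \<subseteq> P"
      using \<open>bt \<in> P\<close> \<open>tp \<in> P\<close> by (auto simp: order_on_defs)
    moreover have "sorted_wrt (\<noteq>) c"
      by (rule sorted_wrt_mono_rel[OF _ s]) blast
    then have "distinct c"
      by (simp add: distinct_conv_nth sorted_wrt_iff_nth_less)
         (metis nat_neq_iff)
    ultimately show "c \<in> {xs. set xs \<subseteq> P \<and> length xs \<le> card P}"
      using fin by (metis (mono_tags) mem_Collect_eq card_mono distinct_card)
  qed
  show "finite {xs. set xs \<subseteq> P \<and> length xs \<le> card P}"
    by (rule finite_lists_length_le[OF fin])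
qed


section \<open>Level posets\<close>

definition level_cover :: "nat mat \<Rightarrow> ((nat \<times> int) \<times> (nat \<times> int)) set" where
  "level_cover X =
     {((i, s), (j, s + 1)) |i j s. i < dim_row X \<and> j < dim_col X \<and> X $$ (i, j) = 1}"

definition level_carrier :: "nat mat \<Rightarrow> (nat \<times> int) set" where
  "level_carrier X = {..<dim_row X} \<times> UNIV"

definition level_order :: "nat mat \<Rightarrow> ((nat \<times> int) \<times> (nat \<times> int)) set" where
  "level_order X = Restr ((level_cover X)\<^sup>*) (level_carrier X)"

definition level_interval :: "nat mat \<Rightarrow> nat \<times> int \<Rightarrow> nat \<times> int \<Rightarrow> (nat \<times> int) set" where
  "level_interval X x y = interval (level_order X) x y"

definition level_interval_order ::
    "nat mat \<Rightarrow> nat \<times> int \<Rightarrow> nat \<times> int \<Rightarrow> ((nat \<times> int) \<times> (nat \<times> int)) set" where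
  "level_interval_order X x y = Restr (level_order X) (level_interval X x y)"


section \<open>The block matrix\<close>

definition mat_A :: "nat \<Rightarrow> nat mat" where
  "mat_A r = mat (r + 1) (r + 1) (\<lambda>(i, j). if i = 0 then 1 else 0)"

definition mat_B :: "nat \<Rightarrow> nat mat" where
  "mat_B r = mat (r + 1) (r + 1)
     (\<lambda>(i, j). if 0 \<le> int i - int j \<and> int i - int j \<le> 1 then 1 else 0)"

definition mat_J :: "nat \<Rightarrow> nat mat" where
  "mat_J r = mat (r + 1) (r + 1) (\<lambda>(i, j). 1)"

definition mat_A_dagger :: "nat \<Rightarrow> nat mat" where
  "mat_A_dagger r = mat (r + 1) (r + 1) (\<lambda>(i, j). if j = r then 1 else 0)"

definition mat_M :: "nat \<Rightarrow> nat mat" where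
  "mat_M r = four_block_mat (mat_A r) (mat_B r) (mat_J r) (mat_A_dagger r)"

end

theory Submission
  imports Defs
begin

text \<open>
  Call a row index between \<open>1\<close> and \<open>r\<close> and a column index between \<open>r + 1\<close> and \<open>2 r\<close> small.
  In the level poset of \<open>M\<close> any two indices are joined by a path of any given length at least
  two, except that there is no path of length two from a small row to a small column. Hence the
  numbers of elements on each level of an interval are explicit, and their alternating sums
  vanish, so the intervals are Eulerian.

  Splitting chains at their first inner element shows that, for a target \<open>j\<close> that is not small,
  the \<open>ab\<close>-index of an interval of rank \<open>n\<close> depends only on \<open>n\<close> and on whether the source is
  small. With \<open>P n\<close> for the other sources and \<open>Q n\<close> for the small ones, and \<open>Q 1 = 0\<close>
  as a convention, one finds for \<open>n \<ge> 3\<close> that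
  \<open>P n - (a - b) P (n - 1) = b (2 P (n - 1) + r Q (n - 1)) + r (a - b) b P (n - 2)\<close> and
  \<open>Q n = c P (n - 1)\<close>. This gives \<open>P n = c P (n - 1) + r d P (n - 2)\<close>, which is also
  the recursion of the \<open>cd\<close>-polynomial, by the first letter of \<open>w\<close>.
\<close>

section \<open>Chains and level posets\<close>

lemma level_order_trans: "trans (level_order X)"
  unfolding level_order_def by (intro trans_Restr trans_rtrancl)

lemma level_order_refl: "x \<in> level_carrier X \<Longrightarrow> (x, x) \<in> level_order X"
  by (simp add: level_order_def)

lemma level_cover_rtrancl_snd:
  assumes "(x, y) \<in> (level_cover X)\<^sup>*"
  shows "x = y \<or> snd x < snd y"
  using assms by induction (auto simp: level_cover_def)

lemma level_order_antisym: "antisym (level_order X)"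
  unfolding antisym_def level_order_def
  by (auto dest!: level_cover_rtrancl_snd simp: prod_eq_iff)

lemma level_order_strict_snd:
  "(x, y) \<in> level_order X \<Longrightarrow> x \<noteq> y \<Longrightarrow> snd x < snd y"
  unfolding level_order_def using level_cover_rtrancl_snd by blast

lemma finite_level_interval: "finite (level_interval X x y)"
proof (rule finite_subset)
  show "level_interval X x y \<subseteq> {..<dim_row X} \<times> {snd x..snd y}"
  proof
    fix z assume "z \<in> level_interval X x y"
    then have z: "(x, z) \<in> level_order X" "(z, y) \<in> level_order X"
      by (auto simp: level_interval_def interval_def)
    then have "snd x \<le> snd z" "snd z \<le> snd y"
      using level_order_strict_snd by fastforce+
    moreover have "fst z < dim_row X"
      using z by (auto simp: level_order_def level_carrier_def)
    ultimately show "z \<in> {..<dim_row X} \<times> {snd x..snd y}"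
      by (cases z) auto
  qed
qed simp

text \<open>By transitivity, all that lies between two elements of an interval stays in it. The
  Eulerian condition can thus be checked in the whole order.\<close>

lemma interval_Restr:
  assumes "trans r" "(u, v) \<in> r" "u \<in> interval r x y" "v \<in> interval r x y"
  shows "interval (Restr r (interval r x y)) u v = interval r u v"
  using assms unfolding interval_def trans_def by blast

text \<open>Every member of a chain from \<open>x\<close> to \<open>y\<close> lies in the interval;
  for the two ends this is reflexivity.\<close>

lemma chains_between_Restr:
  assumes tr: "trans r" and "(x, x) \<in> r" "(y, y) \<in> r"
  shows "chains_between (Restr r (interval r x y)) x y = chains_between r x y"
proof -
  let ?I = "interval r x y"
  have "sorted_wrt (\<lambda>u v. (u, v) \<in> r \<and> u \<noteq> v) (x # zs @ [y]) \<longleftrightarrow>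
        sorted_wrt (\<lambda>u v. (u, v) \<in> Restr r ?I \<and> u \<noteq> v) (x # zs @ [y])" (is "?l \<longleftrightarrow> ?r") for zs
  proof
    assume l: ?l
    then have "set (x # zs @ [y]) \<subseteq> ?I"
      using assms by (auto simp: sorted_wrt_append interval_def)
    then show ?r
      by (intro sorted_wrt_mono_rel[OF _ l]) auto
  next
    assume r: ?r
    show ?l by (rule sorted_wrt_mono_rel[OF _ r]) auto
  qed
  then show ?thesis unfolding chains_between_def by simp
qed

section \<open>Decomposition of chains by their first inner element\<close>

lemma chains_between_Cons_Cons:
  "c \<in> chains_between r z y \<Longrightarrow> \<exists>w ws. c = z # w # ws"
  unfolding chains_between_def by (auto simp: neq_Nil_conv append_eq_Cons_conv)
    (metis append_Cons append_Nil neq_Nil_conv)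

lemma chains_between_rec:
  assumes tr: "trans r" and as: "antisym r" and "(x, y) \<in> r" "x \<noteq> y"
  shows "chains_between r x y =
    insert [x, y] (\<Union>z\<in>interval r x y - {x, y}. (#) x ` chains_between r z y)"
    (is "?L = ?R")
proof
  show "?L \<subseteq> ?R"
  proof
    fix c assume "c \<in> ?L"
    then obtain zs where c: "c = x # zs @ [y]"
      and s: "sorted_wrt (\<lambda>u v. (u, v) \<in> r \<and> u \<noteq> v) (x # zs @ [y])"
      unfolding chains_between_def by blast
    show "c \<in> ?R"
    proof (cases zs)
      case Nil
      then show ?thesis by (simp add: c)
    next
      case (Cons z ws)
      then have "z \<in> interval r x y - {x, y}" "z # ws @ [y] \<in> chains_between r z y"
        using s by (auto simp: interval_def chains_between_def)
      then show ?thesis using c Cons by auto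
    qed
  qed
  show "?R \<subseteq> ?L"
  proof
    fix c assume "c \<in> ?R"
    then consider "c = [x, y]" | z zs where "z \<in> interval r x y - {x, y}" "c = x # z # zs @ [y]"
      "sorted_wrt (\<lambda>u v. (u, v) \<in> r \<and> u \<noteq> v) (z # zs @ [y])"
      unfolding chains_between_def by auto
    then show "c \<in> ?L"
    proof cases
      case 1
      then show ?thesis using assms unfolding chains_between_def by force
    next
      case (2 z zs)
      have "(x, u) \<in> r \<and> x \<noteq> u" if "u \<in> set (z # zs @ [y])" for u
      proof -
        have xz: "(x, z) \<in> r" "x \<noteq> z" using 2 by (auto simp: interval_def)
        moreover have "u = z \<or> (z, u) \<in> r" using that 2 by auto
        \<comment> \<open>Antisymmetry excludes \<open>u = x\<close>, which would give both
          \<open>x < z\<close> and \<open>z \<le> x\<close>.\<close>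
        ultimately show ?thesis using tr as by (metis antisymD transD)
      qed
      with 2(3) have "sorted_wrt (\<lambda>u v. (u, v) \<in> r \<and> u \<noteq> v) (x # (z # zs) @ [y])" by auto
      then show ?thesis unfolding chains_between_def 2(2) by force
    qed
  qed
qed

lemma ab_index_rec:
  assumes tr: "trans r" and as: "antisym r" and xy: "(x, y) \<in> r" "x \<noteq> y"
    and fin: "finite (interval r x y)"
    and fc: "\<And>z. finite (chains_between r z y)"
  shows "ab_index r \<rho> x y = (ab_a - ab_b) ^ nat (\<rho> y - \<rho> x - 1) +
    (\<Sum>z\<in>interval r x y - {x, y}.
       (ab_a - ab_b) ^ nat (\<rho> z - \<rho> x - 1) * ab_b * ab_index r \<rho> z y)"
proof -
  let ?U = "\<Union>z\<in>interval r x y - {x, y}. (#) x ` chains_between r z y"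
  have fU: "finite ?U" using fin fc by auto
  have nin: "[x, y] \<notin> ?U"
    using chains_between_Cons_Cons by fastforce
  have "ab_index r \<rho> x y = chain_weight \<rho> [x, y] + (\<Sum>c\<in>?U. chain_weight \<rho> c)"
    unfolding ab_index_def chains_between_rec[OF tr as xy] using fU nin by simp
  also have "(\<Sum>c\<in>?U. chain_weight \<rho> c) =
    (\<Sum>z\<in>interval r x y - {x, y}. \<Sum>c\<in>(#) x ` chains_between r z y. chain_weight \<rho> c)"
    \<comment> \<open>The second entry of a list recovers \<open>z\<close>, so the union is
      disjoint.\<close>
    using fin fc by (intro sum.UNION_disjoint)
      (auto dest!: chains_between_Cons_Cons)
  also have "\<dots> = (\<Sum>z\<in>interval r x y - {x, y}.
       (ab_a - ab_b) ^ nat (\<rho> z - \<rho> x - 1) * ab_b * ab_index r \<rho> z y)"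
  proof (rule sum.cong[OF refl])
    fix z
    have "(\<Sum>c\<in>(#) x ` chains_between r z y. chain_weight \<rho> c) =
      (\<Sum>c\<in>chains_between r z y. chain_weight \<rho> (x # c))"
      by (simp add: sum.reindex)
    also have "\<dots> = (\<Sum>c\<in>chains_between r z y.
        (ab_a - ab_b) ^ nat (\<rho> z - \<rho> x - 1) * ab_b * chain_weight \<rho> c)"
      by (rule sum.cong[OF refl]) (auto dest!: chains_between_Cons_Cons)
    finally show "(\<Sum>c\<in>(#) x ` chains_between r z y. chain_weight \<rho> c) =
      (ab_a - ab_b) ^ nat (\<rho> z - \<rho> x - 1) * ab_b * ab_index r \<rho> z y"
      by (simp add: ab_index_def sum_distrib_left)
  qed
  finally show ?thesis by simp
qed

section \<open>Reachability in the level poset of \<open>M\<close>\<close>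

text \<open>
  For \<open>i = 0\<close> the disjunct \<open>j = i + r\<close>, which comes from block \<open>B\<close>, yields an entry of block \<open>A\<close>
  that equals \<open>1\<close> as well.
\<close>

definition M_edge :: "nat \<Rightarrow> nat \<Rightarrow> nat \<Rightarrow> bool" where
  "M_edge r i j \<longleftrightarrow> (i = 0 \<and> j \<le> r) \<or> (i \<le> r \<and> (j = i + r \<or> j = i + r + 1)) \<or>
     (r < i \<and> (j \<le> r \<or> j = 2 * r + 1))"

definition M_reach :: "nat \<Rightarrow> nat \<Rightarrow> nat \<Rightarrow> nat \<Rightarrow> bool" where
  "M_reach r n i j \<longleftrightarrow>
     (if n = 0 then i = j
      else if n = 1 then M_edge r i j
      else if n = 2 then \<not> (1 \<le> i \<and> i \<le> r \<and> r < j \<and> j \<le> 2 * r)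
      else True)"

lemma mat_M_dim: "dim_row (mat_M r) = 2 * r + 2" "dim_col (mat_M r) = 2 * r + 2"
  by (simp_all add: mat_M_def mat_A_def mat_A_dagger_def)

text \<open>Block \<open>B\<close> has column index \<open>j - (r + 1)\<close>, so its two diagonals
  become \<open>j = i + r + 1\<close> and \<open>j = i + r\<close>.\<close>

lemma mat_M_eq_1_iff:
  assumes "i < 2 * r + 2" "j < 2 * r + 2"
  shows "mat_M r $$ (i, j) = 1 \<longleftrightarrow> M_edge r i j"
proof -
  have dims: "i < dim_row (mat_A r) + dim_row (mat_A_dagger r)"
    "j < dim_col (mat_A r) + dim_col (mat_A_dagger r)"
    using assms by (simp_all add: mat_A_def mat_A_dagger_def)
  show ?thesis
    unfolding mat_M_def index_mat_four_block(1)[OF dims] M_edge_def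
    using assms by (auto simp: mat_A_def mat_B_def mat_J_def mat_A_dagger_def)
qed

lemma level_cover_M:
  "((i, s), (j, t)) \<in> level_cover (mat_M r) \<longleftrightarrow>
     i < 2 * r + 2 \<and> j < 2 * r + 2 \<and> t = s + 1 \<and> M_edge r i j"
  by (auto simp: level_cover_def mat_M_dim simp flip: mat_M_eq_1_iff)

text \<open>This recursion on the first edge is what makes the closed form \<open>M_reach\<close>
  describe paths of length \<open>n\<close>.\<close>

lemma M_reach_Suc:
  assumes "i < 2 * r + 2" "j < 2 * r + 2"
  shows "M_reach r (Suc n) i j \<longleftrightarrow> (\<exists>m < 2 * r + 2. M_edge r i m \<and> M_reach r n m j)"
proof
  assume "\<exists>m < 2 * r + 2. M_edge r i m \<and> M_reach r n m j"
  then obtain m where "M_edge r i m" "M_reach r n m j" by blast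
  then show "M_reach r (Suc n) i j"
    using assms by (auto simp: M_reach_def M_edge_def numeral_eq_Suc split: if_splits)
next
  assume re: "M_reach r (Suc n) i j"
  consider "n = 0" | "n = 1" | "n \<ge> 2" by linarith
  then show "\<exists>m < 2 * r + 2. M_edge r i m \<and> M_reach r n m j"
  proof cases
    case 1
    then show ?thesis using re assms by (auto simp: M_reach_def)
  next
    case 2
    \<comment> \<open>A common neighbour of \<open>i\<close> and \<open>j\<close>. From a small row,
      \<open>i + r + 1\<close> leads to every column that is not small; from another row to a column
      beyond \<open>r\<close>, the diagonal of \<open>B\<close> gives
      \<open>j - (r + 1)\<close>.\<close>
    let ?m = "if i = 0 \<and> j \<le> r then 0 else if i \<noteq> 0 \<and> i \<le> r then i + r + 1
      else if j \<le> r then 2 * r + 1 else j - (r + 1)"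
    have "?m < 2 * r + 2" "M_edge r i ?m" "M_edge r ?m j"
      using re assms 2 by (auto simp: M_reach_def M_edge_def)
    then show ?thesis using 2 by (auto simp: M_reach_def)
  next
    case 3
    \<comment> \<open>A neighbour of \<open>i\<close> that is not a small row reaches everything in
      two or more steps.\<close>
    let ?m = "if i \<noteq> 0 \<and> i \<le> r then i + r + 1 else 0"
    have "?m < 2 * r + 2 \<and> M_edge r i ?m \<and> M_reach r n ?m j"
      using assms 3 by (auto simp: M_reach_def M_edge_def)
    then show ?thesis by blast
  qed
qed

text \<open>Each cover raises the level by one, so comparability means a path whose length is the
  difference of levels.\<close>

lemma level_order_M:
  "((i, s), (j, t)) \<in> level_order (mat_M r) \<longleftrightarrow>
     i < 2 * r + 2 \<and> j < 2 * r + 2 \<and> s \<le> t \<and> M_reach r (nat (t - s)) i j"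
proof -
  have 1: "fst x < 2 * r + 2 \<longrightarrow> fst x < 2 * r + 2 \<and> snd x \<le> t \<and> M_reach r (nat (t - snd x)) (fst x) j"
    if "j < 2 * r + 2" "(x, (j, t)) \<in> (level_cover (mat_M r))\<^sup>*" for x
    using that(2)
  proof (induction rule: converse_rtrancl_induct)
    case base
    then show ?case by (simp add: M_reach_def)
  next
    case (step x y)
    obtain i s m u where xy: "x = (i, s)" "y = (m, u)" by (metis surj_pair)
    from step.hyps(1) have e: "i < 2 * r + 2" "m < 2 * r + 2" "u = s + 1" "M_edge r i m"
      by (auto simp: xy level_cover_M)
    with step.IH have "s + 1 \<le> t" "M_reach r (nat (t - (s + 1))) m j"
      by (auto simp: xy)
    moreover from this have "nat (t - s) = Suc (nat (t - (s + 1)))" by simp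
    ultimately show ?case using e that(1) by (auto simp: xy M_reach_Suc)
  qed
  have 2: "((i, s), (j, s + int n)) \<in> (level_cover (mat_M r))\<^sup>*"
    if "i < 2 * r + 2" "j < 2 * r + 2" "M_reach r n i j" for i s n
    using that
  proof (induction n arbitrary: i s)
    case 0
    then show ?case by (simp add: M_reach_def)
  next
    case (Suc n)
    then obtain m where m: "m < 2 * r + 2" "M_edge r i m" "M_reach r n m j"
      by (auto simp: M_reach_Suc)
    have "((i, s), (m, s + 1)) \<in> level_cover (mat_M r)"
      using m Suc.prems by (simp add: level_cover_M)
    moreover have "((m, s + 1), (j, s + 1 + int n)) \<in> (level_cover (mat_M r))\<^sup>*"
      using Suc m by blast
    moreover have "s + int (Suc n) = s + 1 + int n" by simp
    ultimately show ?case by (simp only: converse_rtrancl_into_rtrancl)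
  qed
  have mem: "((i, s), (j, t)) \<in> level_order (mat_M r) \<longleftrightarrow>
      i < 2 * r + 2 \<and> j < 2 * r + 2 \<and> ((i, s), (j, t)) \<in> (level_cover (mat_M r))\<^sup>*"
    by (auto simp: level_order_def level_carrier_def mat_M_dim)
  show ?thesis
    unfolding mem using 1[of "(i, s)"] 2[of i "nat (t - s)" s] by auto
qed

text \<open>The small rows have only two ones; all other rows have \<open>r + 2\<close>.\<close>

definition small_src :: "nat \<Rightarrow> nat \<Rightarrow> bool" where
  "small_src r i \<longleftrightarrow> 1 \<le> i \<and> i \<le> r"

definition small_tgt :: "nat \<Rightarrow> nat \<Rightarrow> bool" where
  "small_tgt r j \<longleftrightarrow> r < j \<and> j \<le> 2 * r"

lemma M_reach_simps:
  "M_reach r 0 i j \<longleftrightarrow> i = j"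
  "M_reach r (Suc 0) i j \<longleftrightarrow> M_edge r i j"
  "M_reach r 1 i j \<longleftrightarrow> M_edge r i j"
  "M_reach r 2 i j \<longleftrightarrow> \<not> (small_src r i \<and> small_tgt r j)"
  "n \<ge> 3 \<Longrightarrow> M_reach r n i j"
  by (auto simp: M_reach_def small_src_def small_tgt_def)

lemma M_reach_ge2: "n \<ge> 2 \<Longrightarrow> \<not> small_src r i \<or> \<not> small_tgt r j \<Longrightarrow> M_reach r n i j"
  by (auto simp: M_reach_def small_src_def small_tgt_def)

section \<open>Counting neighbours and elements at distance two\<close>

lemma edges_from:
  assumes "i < 2 * r + 2"
  shows "{m. m < 2 * r + 2 \<and> M_edge r i m} =
    (if small_src r i then {i + r, i + r + 1} else if i = 0 then {..r + 1} else insert (2 * r + 1) {..r})"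
  using assms by (auto simp: M_edge_def small_src_def)

lemma edges_to:
  assumes "j < 2 * r + 2"
  shows "{m. m < 2 * r + 2 \<and> M_edge r m j} =
    (if small_tgt r j then {j - r - 1, j - r} else if j \<le> r then insert 0 {r + 1..2 * r + 1} else {r..2 * r + 1})"
  using assms by (auto simp: M_edge_def small_tgt_def)

lemma card_edges_from:
  "i < 2 * r + 2 \<Longrightarrow> card {m. m < 2 * r + 2 \<and> M_edge r i m} = (if small_src r i then 2 else r + 2)"
  by (subst edges_from) auto

lemma card_edges_to:
  "j < 2 * r + 2 \<Longrightarrow> card {m. m < 2 * r + 2 \<and> M_edge r m j} = (if small_tgt r j then 2 else r + 2)"
  by (subst edges_to) (auto simp: small_tgt_def)

lemma card_not_small_src: "card {m. m < 2 * r + 2 \<and> \<not> small_src r m} = r + 2"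
proof -
  have "{m. m < 2 * r + 2 \<and> \<not> small_src r m} = insert 0 {r + 1..2 * r + 1}"
    by (auto simp: small_src_def)
  then show ?thesis by simp
qed

lemma card_not_small_tgt: "card {m. m < 2 * r + 2 \<and> \<not> small_tgt r m} = r + 2"
proof -
  have "{m. m < 2 * r + 2 \<and> \<not> small_tgt r m} = insert (2 * r + 1) {..r}"
    by (auto simp: small_tgt_def)
  then show ?thesis by simp
qed

lemma card_not_small_src_tgt: "card {m. m < 2 * r + 2 \<and> \<not> small_src r m \<and> \<not> small_tgt r m} = 2"
proof -
  have "{m. m < 2 * r + 2 \<and> \<not> small_src r m \<and> \<not> small_tgt r m} = {0, 2 * r + 1}"
    by (auto simp: small_src_def small_tgt_def)
  then show ?thesis by simp
qed

lemma card_small_src: "card {m. m < 2 * r + 2 \<and> small_src r m} = r"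
proof -
  have "{m. m < 2 * r + 2 \<and> small_src r m} = {1..r}"
    by (auto simp: small_src_def)
  then show ?thesis by simp
qed

text \<open>A small row leads only to \<open>i + r\<close> and \<open>i + r + 1\<close>, both beyond
  \<open>r\<close>; a small column is entered only from rows up to \<open>r\<close>.\<close>

lemma M_edge_not_small:
  "small_src r i \<Longrightarrow> M_edge r i m \<Longrightarrow> \<not> small_src r m"
  "small_tgt r j \<Longrightarrow> M_edge r m j \<Longrightarrow> \<not> small_tgt r m"
  by (auto simp: M_edge_def small_src_def small_tgt_def)

lemma src_cases:
  assumes "i < 2 * r + 2"
  obtains "small_src r i" | "i = 0" "\<not> small_src r i" | "r < i" "\<not> small_src r i"
  using assms by (auto simp: small_src_def) linarith

lemma tgt_cases:
  assumes "j < 2 * r + 2"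
  obtains "small_tgt r j" | "j \<le> r" "\<not> small_tgt r j" | "j = 2 * r + 1" "\<not> small_tgt r j"
  using assms by (auto simp: small_tgt_def) linarith

text \<open>Intervals of rank two are diamonds. The inner elements form the intersection of the
  neighbours above \<open>i\<close> and below \<open>j\<close>, computed for each type of row and
  column.\<close>

lemma card_diamond:
  assumes ij: "i < 2 * r + 2" "j < 2 * r + 2" and re: "\<not> (small_src r i \<and> small_tgt r j)"
  shows "card {m. m < 2 * r + 2 \<and> M_edge r i m \<and> M_edge r m j} = 2" (is "card ?S = 2")
proof -
  have S: "?S = {m. m < 2 * r + 2 \<and> M_edge r i m} \<inter> {m. m < 2 * r + 2 \<and> M_edge r m j}"
    by auto
  show ?thesis
  proof (cases rule: src_cases[OF ij(1)])
    case 1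
    have "?S = {i + r, i + r + 1}"
      using re ij(2) 1 unfolding S edges_from[OF ij(1)] edges_to[OF ij(2)]
      by (cases rule: tgt_cases[OF ij(2)]) (auto simp: small_src_def)
    then show ?thesis by simp
  next
    case i: 2
    show ?thesis
    proof (cases rule: tgt_cases[OF ij(2)])
      case 1
      have "?S = {j - r - 1, j - r}"
        using i 1 unfolding S edges_from[OF ij(1)] edges_to[OF ij(2)]
        by (auto simp: small_tgt_def)
      moreover have "j - r - 1 \<noteq> j - r" using 1 by (auto simp: small_tgt_def)
      ultimately show ?thesis by simp
    next
      case 2
      have "?S = {0, r + 1}"
        using i 2 unfolding S edges_from[OF ij(1)] edges_to[OF ij(2)] by auto
      then show ?thesis by simp
    next
      case 3
      have "?S = {r, r + 1}"
        using i 3 unfolding S edges_from[OF ij(1)] edges_to[OF ij(2)] by auto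
      then show ?thesis by simp
    qed
  next
    case i: 3
    show ?thesis
    proof (cases rule: tgt_cases[OF ij(2)])
      case 1
      have "?S = {j - r - 1, j - r}"
        using i 1 unfolding S edges_from[OF ij(1)] edges_to[OF ij(2)]
        by (auto simp: small_tgt_def)
      moreover have "j - r - 1 \<noteq> j - r" using 1 by (auto simp: small_tgt_def)
      ultimately show ?thesis by simp
    next
      case 2
      have "?S = {0, 2 * r + 1}"
        using i 2 unfolding S edges_from[OF ij(1)] edges_to[OF ij(2)] by auto
      then show ?thesis by simp
    next
      case 3
      have "?S = {r, 2 * r + 1}"
        using i 3 unfolding S edges_from[OF ij(1)] edges_to[OF ij(2)] by auto
      then show ?thesis by simp
    qed
  qed
qed

text \<open>The lower inner level of an interval of rank three. Its size equals that of the upper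
  level in \<open>card_reach2_edge\<close>, as the Eulerian condition demands.\<close>

lemma card_edge_reach2:
  assumes ij: "i < 2 * r + 2" "j < 2 * r + 2"
  shows "card {m. m < 2 * r + 2 \<and> M_edge r i m \<and> \<not> (small_src r m \<and> small_tgt r j)} =
    (if small_src r i \<or> small_tgt r j then 2 else r + 2)" (is "card ?S = _")
proof (cases "small_tgt r j \<and> \<not> small_src r i")
  case True
  then have "?S = {m. m < 2 * r + 2 \<and> M_edge r i m} \<inter> {m. \<not> small_src r m}" by auto
  also have "\<dots> = {0, if i = 0 then r + 1 else 2 * r + 1}"
    using True unfolding edges_from[OF ij(1)] by (auto simp: small_src_def)
  finally show ?thesis using True by simp
next
  case False
  \<comment> \<open>The condition on \<open>m\<close> is automatic here, since a small row has no
    small successor.\<close>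
  then have "?S = {m. m < 2 * r + 2 \<and> M_edge r i m}"
    using M_edge_not_small(1)[of r i] by blast
  then have "card ?S = (if small_src r i then 2 else r + 2)"
    by (simp only: card_edges_from[OF ij(1)])
  then show ?thesis using False by presburger
qed

lemma card_reach2_edge:
  assumes ij: "i < 2 * r + 2" "j < 2 * r + 2"
  shows "card {m. m < 2 * r + 2 \<and> \<not> (small_src r i \<and> small_tgt r m) \<and> M_edge r m j} =
    (if small_src r i \<or> small_tgt r j then 2 else r + 2)" (is "card ?S = _")
proof (cases "small_src r i \<and> \<not> small_tgt r j")
  case True
  then have "?S = {m. m < 2 * r + 2 \<and> M_edge r m j} \<inter> {m. \<not> small_tgt r m}" by auto
  also have "\<dots> = {2 * r + 1, if j = 2 * r + 1 then r else 0}"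
    using True ij unfolding edges_to[OF ij(2)] by (auto simp: small_tgt_def)
  finally show ?thesis using True by (auto simp: small_src_def)
next
  case False
  then have "?S = {m. m < 2 * r + 2 \<and> M_edge r m j}"
    using M_edge_not_small(2)[of r j] by blast
  then have "card ?S = (if small_tgt r j then 2 else r + 2)"
    by (simp only: card_edges_to[OF ij(2)])
  then show ?thesis using False by presburger
qed

section \<open>Eulerian intervals\<close>

text \<open>Elements at height \<open>s\<close> in an interval of rank \<open>n\<close>; by
  translation invariance only their indices are recorded.\<close>

definition lev :: "nat \<Rightarrow> nat \<Rightarrow> nat \<Rightarrow> nat \<Rightarrow> nat \<Rightarrow> nat set" where
  "lev r i j n s = {m. m < 2 * r + 2 \<and> M_reach r s i m \<and> M_reach r (n - s) m j}"

lemma sum_lessThan_add: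
  "(\<Sum>s<m + n. f s) = (\<Sum>s<m. f s) + (\<Sum>s<n. f (m + s))" for f :: "nat \<Rightarrow> 'a::comm_monoid_add"
  by (induction n) (simp_all add: add.assoc)

lemma lev_ends:
  assumes "i < 2 * r + 2" "j < 2 * r + 2" "M_reach r n i j"
  shows "lev r i j n 0 = {i}" "lev r i j n n = {j}"
  using assms by (auto simp: lev_def M_reach_simps)

text \<open>From heights one and two the target is at least three steps away, so only the source
  imposes a condition.\<close>

lemma card_lev_2:
  assumes "i < 2 * r + 2" "n \<ge> 5"
  shows "card (lev r i j n 1) = (if small_src r i then 2 else r + 2)"
    "card (lev r i j n 2) = (if small_src r i then r + 2 else 2 * r + 2)"
  using assms card_edges_from[of i r] card_not_small_tgt[of r]
  by (auto simp: lev_def M_reach_simps)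

lemma card_lev_n_2:
  assumes "j < 2 * r + 2" "n \<ge> 5"
  shows "card (lev r i j n (n - 1)) = (if small_tgt r j then 2 else r + 2)"
    "card (lev r i j n (n - 2)) = (if small_tgt r j then r + 2 else 2 * r + 2)"
  using assms card_edges_to[of j r] card_not_small_src[of r]
  by (auto simp: lev_def M_reach_simps)

lemma card_lev_mid:
  assumes "3 \<le> s" "3 \<le> n - s"
  shows "card (lev r i j n s) = 2 * r + 2"
  using assms by (simp add: lev_def M_reach_simps)

text \<open>Up to rank four, conditions from both ends can meet on one level, so these ranks are
  checked separately. From rank five on, the three lowest levels, the full levels between and the
  three highest levels are summed apart.\<close>

lemma alternating_sum_lev:
  assumes ij: "i < 2 * r + 2" "j < 2 * r + 2" and re: "M_reach r n i j" and n: "n > 0"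
  shows "(\<Sum>s\<le>n. (-1) ^ s * int (card (lev r i j n s))) = 0"
proof -
  let ?f = "\<lambda>s. card (lev r i j n s)"
  have ends: "?f 0 = 1" "?f n = 1" using lev_ends[OF ij re] by auto
  consider "n = 1" | "n = 2" | "n = 3" | "n = 4" | "n \<ge> 5" using n by linarith
  then show ?thesis
  proof cases
    case 1
    then show ?thesis using ends by simp
  next
    case 2
    have "?f 1 = 2" using card_diamond[OF ij] re by (simp add: lev_def M_reach_simps 2)
    then show ?thesis using ends by (simp add: 2 numeral_eq_Suc)
  next
    case 3
    have "?f 1 = ?f 2"
      using card_edge_reach2[OF ij] card_reach2_edge[OF ij]
      by (simp add: lev_def M_reach_simps 3)
    then show ?thesis using ends by (simp add: 3 numeral_eq_Suc)
  next
    case 4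
    have "?f 1 = (if small_src r i then 2 else r + 2)"
      using card_edges_from[OF ij(1)] by (simp add: lev_def M_reach_simps 4)
    moreover have "?f 3 = (if small_tgt r j then 2 else r + 2)"
      using card_edges_to[OF ij(2)] by (simp add: lev_def M_reach_simps 4)
    moreover have "?f 2 = (if small_src r i then if small_tgt r j then 2 else r + 2
        else if small_tgt r j then r + 2 else 2 * r + 2)"
      using card_not_small_src[of r] card_not_small_tgt[of r] card_not_small_src_tgt[of r]
      by (auto simp: lev_def M_reach_simps 4 conj_commute)
    ultimately have "2 + int (?f 2) = int (?f 1) + int (?f 3)" by auto
    then show ?thesis using ends by (simp add: 4 numeral_eq_Suc)
  next
    case 5
    then obtain k where k: "n = k + 5" by (metis le_add_diff_inverse2)
    let ?g = "\<lambda>s. (-1) ^ s * int (?f s)"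
    have alt: "(\<Sum>s<k. (-1) ^ s) = (if even k then 0 else 1 :: int)"
      by (induction k) auto
    have "{..n} = {..<3 + (k + 3)}" using k by auto
    then have "(\<Sum>s\<le>n. ?g s) = (\<Sum>s<3. ?g s) + (\<Sum>s<k. ?g (3 + s)) + (\<Sum>s<3. ?g (3 + (k + s)))"
      by (simp only: sum_lessThan_add add.assoc)
    \<comment> \<open>Small or not, the source gives the same value: \<open>1 - 2 + (r + 2)\<close>
      or \<open>1 - (r + 2) + (2 * r + 2)\<close>.\<close>
    also have "(\<Sum>s<3. ?g s) = int r + 1"
      using ends(1) card_lev_2[OF ij(1) 5, of j] by (simp add: numeral_eq_Suc)
    also have "(\<Sum>s<k. ?g (3 + s)) = (\<Sum>s<k. (-1) ^ s * - int (2 * r + 2))"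
      by (rule sum.cong) (auto simp: card_lev_mid k power_add algebra_simps)
    also have "\<dots> = (if even k then 0 else 1) * - int (2 * r + 2)"
      unfolding alt[symmetric] sum_distrib_right ..
    also have "(\<Sum>s<3. ?g (3 + (k + s))) = - ((-1) ^ k * (int r + 1))"
    proof -
      have "n - 2 = Suc (Suc (Suc k))" "n - 1 = Suc (Suc (Suc (Suc k)))"
        "n = Suc (Suc (Suc (Suc (Suc k))))" using k by auto
      then show ?thesis
        using ends(2) card_lev_n_2[OF ij(2) 5, of i] by (simp add: numeral_eq_Suc algebra_simps)
    qed
    finally show ?thesis by auto
  qed
qed

text \<open>Grouping by height serves both the parity count and the chain recursion.\<close>

lemma sum_level_interval:
  assumes ij: "i < 2 * r + 2" "j < 2 * r + 2"
  shows "(\<Sum>z\<in>interval (level_order (mat_M r)) (i, a) (j, a + int n). g z) =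
    (\<Sum>s\<le>n. \<Sum>m\<in>lev r i j n s. g (m, a + int s))"
proof -
  let ?h = "\<lambda>(s, m). (m, a + int s)"
  have "interval (level_order (mat_M r)) (i, a) (j, a + int n) = ?h ` Sigma {..n} (lev r i j n)"
  proof (rule equalityI; rule subsetI)
    fix z assume "z \<in> interval (level_order (mat_M r)) (i, a) (j, a + int n)"
    then obtain m t where z: "z = (m, t)" "m < 2 * r + 2" "a \<le> t" "t \<le> a + int n"
      "M_reach r (nat (t - a)) i m" "M_reach r (nat (a + int n - t)) m j"
      by (cases z) (auto simp: interval_def level_order_M)
    moreover have "nat (a + int n - t) = n - nat (t - a)" using z by simp
    ultimately have "(nat (t - a), m) \<in> Sigma {..n} (lev r i j n)" "z = ?h (nat (t - a), m)"
      by (auto simp: lev_def)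
    then show "z \<in> ?h ` Sigma {..n} (lev r i j n)" by blast
  next
    fix z assume "z \<in> ?h ` Sigma {..n} (lev r i j n)"
    then obtain s m where z: "z = (m, a + int s)" "s \<le> n" "m \<in> lev r i j n s" by auto
    moreover have "nat (int n - int s) = n - s" by simp
    ultimately show "z \<in> interval (level_order (mat_M r)) (i, a) (j, a + int n)"
      using ij by (auto simp: interval_def level_order_M lev_def)
  qed
  moreover have "inj_on ?h (Sigma {..n} (lev r i j n))" by (auto simp: inj_on_def)
  moreover have "finite (lev r i j n s)" for s by (simp add: lev_def)
  ultimately show ?thesis
    by (simp add: sum.reindex sum.Sigma case_prod_unfold)
qed

lemma card_parity_level_interval:
  assumes "(x, y) \<in> level_order (mat_M r)" "x \<noteq> y"
  shows "card {z \<in> interval (level_order (mat_M r)) x y. even (snd z)} =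
         card {z \<in> interval (level_order (mat_M r)) x y. odd (snd z)}"
proof -
  let ?I = "interval (level_order (mat_M r)) x y"
  obtain i a where x: "x = (i, a)" by force
  obtain j b where y: "y = (j, b)" by force
  have lt: "a < b" using level_order_strict_snd[OF assms] by (simp add: x y)
  define n where "n = nat (b - a)"
  have b: "b = a + int n" "n > 0" using lt by (auto simp: n_def)
  have ij: "i < 2 * r + 2" "j < 2 * r + 2" "M_reach r n i j"
    using assms(1) by (auto simp: x y level_order_M n_def)
  have fin: "finite ?I"
    using finite_level_interval by (simp add: level_interval_def)
  have "int (card {z \<in> ?I. even (snd z)}) - int (card {z \<in> ?I. odd (snd z)}) =
      (\<Sum>z\<in>?I. if even (snd z) then 1 else - 1)"
    using fin by (simp add: sum.If_cases Int_def conj_commute)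
  also have "\<dots> = (\<Sum>s\<le>n. \<Sum>m\<in>lev r i j n s. if even (a + int s) then 1 else - 1)"
    unfolding x y b(1) sum_level_interval[OF ij(1,2)] by simp
  \<comment> \<open>Ranks are absolute levels, so the parity of the bottom level \<open>a\<close>
    gives a global sign.\<close>
  also have "\<dots> = (\<Sum>s\<le>n. (if even a then 1 else - 1) * ((-1) ^ s * int (card (lev r i j n s))))"
    by (rule sum.cong) (auto simp: minus_one_power_iff)
  also have "\<dots> = 0"
    by (simp only: alternating_sum_lev[OF ij b(2)] mult_zero_right flip: sum_distrib_left)
  finally show ?thesis by simp
qed

lemma graded_level_interval:
  assumes xy: "(x, y) \<in> level_order (mat_M r)"
  shows "graded_poset (level_interval (mat_M r) x y) (level_interval_order (mat_M r) x y) snd x y"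
proof -
  let ?L = "level_order (mat_M r)" and ?I = "level_interval (mat_M r) x y"
    and ?R = "level_interval_order (mat_M r) x y"
  have car: "u \<in> level_carrier (mat_M r)" "v \<in> level_carrier (mat_M r)" if "(u, v) \<in> ?L" for u v
    using that by (auto simp: level_order_def)
  have rf: "(u, u) \<in> ?L" if "u \<in> ?I" for u
    using that car(1)[of u y] by (auto simp: level_interval_def interval_def intro: level_order_refl)
  have xI: "x \<in> ?I" "y \<in> ?I"
    using xy car[OF xy] by (auto simp: level_interval_def interval_def intro: level_order_refl)
  have "refl_on ?I ?R"
    using rf by (auto simp: refl_on_def level_interval_order_def)
  moreover have "trans ?R"
    unfolding level_interval_order_def by (intro trans_Restr level_order_trans)
  moreover have "antisym ?R"
    unfolding level_interval_order_def
    by (rule antisym_subset[OF _ level_order_antisym]) auto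
  moreover have "?R \<subseteq> ?I \<times> ?I" by (auto simp: level_interval_order_def)
  ultimately have po: "partial_order_on ?I ?R"
    by (auto simp: partial_order_on_def preorder_on_def)
  have cov: "snd v = snd u + 1" if "covered_by ?R u v" for u v
  proof (rule ccontr)
    assume ne: "snd v \<noteq> snd u + 1"
    have uv: "(u, v) \<in> ?L" "u \<noteq> v" "u \<in> ?I" "v \<in> ?I"
      using that by (auto simp: covered_by_def level_interval_order_def)
    obtain i a where u: "u = (i, a)" by force
    obtain j b where v: "v = (j, b)" by force
    have ab: "a + 1 < b" using level_order_strict_snd[OF uv(1,2)] ne by (simp add: u v)
    define n where "n = nat (b - (a + 1))"
    have n: "nat (b - a) = Suc n" using ab by (simp add: n_def)
    \<comment> \<open>The first step of a path from \<open>u\<close> to \<open>v\<close> would lie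
      strictly between them.\<close>
    obtain m where m: "m < 2 * r + 2" "M_edge r i m" "M_reach r n m j"
      using uv(1) by (auto simp: u v level_order_M n M_reach_Suc)
    have z: "(u, (m, a + 1)) \<in> ?L" "((m, a + 1), v) \<in> ?L"
      using uv(1) m ab by (auto simp: u v level_order_M n_def M_reach_simps)
    then have "(m, a + 1) \<in> ?I"
      using uv(3,4) level_order_trans unfolding level_interval_def interval_def
      by (auto elim: transE)
    with z uv have "(u, (m, a + 1)) \<in> ?R" "((m, a + 1), v) \<in> ?R"
      by (auto simp: level_interval_order_def)
    with that have "(m, a + 1) = u \<or> (m, a + 1) = v"
      unfolding covered_by_def by blast
    then show False using ab by (auto simp: u v)
  qed
  show ?thesis
    unfolding graded_poset_def
    using finite_level_interval po xI cov
    by (auto simp: level_interval_order_def level_interval_def interval_def)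
qed

lemma Eulerian_level_interval:
  assumes xy: "(x, y) \<in> level_order (mat_M r)"
  shows "Eulerian_poset (level_interval (mat_M r) x y) (level_interval_order (mat_M r) x y) snd x y"
proof -
  have "interval (level_interval_order (mat_M r) x y) u v = interval (level_order (mat_M r)) u v"
    "(u, v) \<in> level_order (mat_M r)"
    if "(u, v) \<in> level_interval_order (mat_M r) x y" for u v
    using that interval_Restr[OF level_order_trans, of u v "mat_M r" x y]
    by (auto simp: level_interval_order_def level_interval_def)
  then show ?thesis
    unfolding Eulerian_poset_def
    using graded_level_interval[OF xy] card_parity_level_interval by auto
qed

section \<open>The recursion for the \<open>cd\<close>-index\<close>

text \<open>The index is the rank: \<open>cd_rec r (Suc k)\<close> has degree \<open>k\<close>. The
  value \<open>0\<close> at rank \<open>0\<close> makes the recursion valid from rank two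
  on.\<close>

fun cd_rec :: "nat \<Rightarrow> nat \<Rightarrow> ab_letter ncpoly" where
  "cd_rec r 0 = 0"
| "cd_rec r (Suc 0) = 1"
| "cd_rec r (Suc (Suc n)) =
     cd_in_ab Let_c * cd_rec r (Suc n) + of_nat r * (cd_in_ab Let_d * cd_rec r n)"

lemma lookup_of_int_mult:
  fixes p :: "'x ncpoly"
  shows "Poly_Mapping.lookup (of_int c * p) x = c * Poly_Mapping.lookup p x"
proof -
  have "of_int c * p = Poly_Mapping.map ((*) c) p"
    by (simp add: mult_map_scale_conv_mult flip: single_of_int)
  then show ?thesis by (simp add: Poly_Mapping.map.rep_eq when_def)
qed

text \<open>\<open>ncsubst\<close> sums over the keys only; words with coefficient \<open>0\<close>
  are put back without changing the sum.\<close>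

lemma ncsubst_sum_ncmono:
  assumes "finite S"
  shows "ncsubst f (\<Sum>w\<in>S. of_int (g w) * ncmono w) =
    (\<Sum>w\<in>S. of_int (g w) * prod_list (map f w))"
proof -
  let ?p = "\<Sum>w\<in>S. of_int (g w) * ncmono w"
  have lk: "Poly_Mapping.lookup ?p (Wd v) = (if v \<in> S then g v else 0)" for v
  proof -
    have "Poly_Mapping.lookup ?p (Wd v) = (\<Sum>w\<in>S. if w = v then g w else 0)"
      unfolding lookup_sum lookup_of_int_mult
      by (rule sum.cong) (auto simp: ncmono_def lookup_single when_def)
    then show ?thesis using assms by simp
  qed
  have sub: "Poly_Mapping.keys ?p \<subseteq> Wd ` S"
  proof
    fix x assume "x \<in> Poly_Mapping.keys ?p"
    then show "x \<in> Wd ` S"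
      by (cases x) (auto simp: in_keys_iff lk split: if_splits)
  qed
  have "ncsubst f ?p = (\<Sum>w\<in>Wd ` S. of_int (Poly_Mapping.lookup ?p w) * prod_list (map f (letters w)))"
    unfolding ncsubst_def using assms sub
    by (intro sum.mono_neutral_left) (auto simp: in_keys_iff)
  also have "\<dots> = (\<Sum>w\<in>S. of_int (g w) * prod_list (map f w))"
    by (subst sum.reindex) (auto simp: inj_on_def lk intro!: sum.cong)
  finally show ?thesis .
qed

lemma cd_degree_simps [simp]:
  "cd_degree (Let_c # w) = Suc (cd_degree w)" "cd_degree (Let_d # w) = Suc (Suc (cd_degree w))"
  "cd_degree [] = 0"
  by (simp_all add: cd_degree_def)

lemma cd_degree_eq_0_iff: "cd_degree w = 0 \<longleftrightarrow> w = []"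
  by (cases w rule: cd_lead.cases) auto

lemma cd_degree_eq_Suc_iff:
  "cd_degree w = Suc n \<longleftrightarrow> (\<exists>v. w = Let_c # v \<and> cd_degree v = n) \<or>
     (\<exists>v. w = Let_d # v \<and> Suc (cd_degree v) = n)"
  by (cases w rule: cd_lead.cases) auto

text \<open>Removing the first letter lowers the degree by one for \<open>c\<close> and by two, with
  a factor \<open>r\<close>, for \<open>d\<close>.\<close>

lemma sum_cd_words:
  "(\<Sum>w | cd_degree w = k. of_nat r ^ count_list w Let_d * prod_list (map cd_in_ab w)) =
   cd_rec r (Suc k)"
proof (induction k rule: less_induct)
  case (less k)
  let ?f = "\<lambda>w. of_nat r ^ count_list w Let_d * prod_list (map cd_in_ab w)"
  have comm: "of_nat r ^ m * (x * y) = x * (of_nat r ^ m * y)" for m and x y :: "ab_letter ncpoly"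
    by (metis mult.assoc mult_of_nat_commute of_nat_power)
  have c: "(\<Sum>w\<in>(#) Let_c ` {w. cd_degree w = m}. ?f w) = cd_in_ab Let_c * (\<Sum>w | cd_degree w = m. ?f w)" for m
    by (subst sum.reindex) (simp_all add: sum_distrib_left comm del: cd_in_ab.simps)
  have d: "(\<Sum>w\<in>(#) Let_d ` {w. cd_degree w = m}. ?f w) =
      of_nat r * (cd_in_ab Let_d * (\<Sum>w | cd_degree w = m. ?f w))" for m
    by (subst sum.reindex) (simp_all add: sum_distrib_left comm mult.assoc del: cd_in_ab.simps)
  consider "k = 0" | "k = 1" | m where "k = Suc (Suc m)" by (metis One_nat_def not0_implies_Suc)
  then show ?case
  proof cases
    case 1
    then show ?thesis by (simp add: cd_degree_eq_0_iff)
  next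
    case 2
    have "{w. cd_degree w = 1} = (#) Let_c ` {w. cd_degree w = 0}"
      by (auto simp: cd_degree_eq_Suc_iff)
    then show ?thesis using 2 c[of 0] less.IH[of 0] by simp
  next
    case (3 m)
    have eq: "{w. cd_degree w = k} =
      (#) Let_c ` {w. cd_degree w = Suc m} \<union> (#) Let_d ` {w. cd_degree w = m}"
      unfolding 3 by (subst cd_degree_eq_Suc_iff) auto
    have "(\<Sum>w | cd_degree w = k. ?f w) = (\<Sum>w\<in>(#) Let_c ` {w. cd_degree w = Suc m}. ?f w) +
        (\<Sum>w\<in>(#) Let_d ` {w. cd_degree w = m}. ?f w)"
      unfolding eq by (rule sum.union_disjoint) (auto simp: finite_cd_degree)
    also have "\<dots> = cd_in_ab Let_c * cd_rec r (Suc (Suc m)) + of_nat r * (cd_in_ab Let_d * cd_rec r (Suc m))"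
      unfolding c d using 3 less.IH[of m] less.IH[of "Suc m"] by simp
    finally show ?thesis using 3 by simp
  qed
qed

lemma ncsubst_cd_sum:
  "ncsubst cd_in_ab (\<Sum>w | cd_degree w = k. of_nat r ^ count_list w Let_d * ncmono w) =
   cd_rec r (Suc k)"
  using ncsubst_sum_ncmono[OF finite_cd_degree, of cd_in_ab "\<lambda>w. int r ^ count_list w Let_d" k]
  by (simp add: sum_cd_words)

text \<open>
  The sum of the \<open>ab\<close>-indices of \<open>[z, y]\<close> over the elements \<open>z\<close> that lie \<open>s + 1\<close> levels above
  a source that is not small and \<open>p\<close> levels below \<open>y\<close>. For \<open>p = 1\<close> the second summand vanishes.
\<close>

definition level_sum_poly :: "nat \<Rightarrow> nat \<Rightarrow> nat \<Rightarrow> ab_letter ncpoly" where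
  "level_sum_poly r s p = of_nat (if s = 0 then 2 else r + 2) * cd_rec r p +
     of_nat r * (cd_in_ab Let_c * cd_rec r (p - 1))"

text \<open>The coefficient changes only from \<open>s = 0\<close> to \<open>s = 1\<close>, where it
  grows by \<open>r\<close>. Hence shifting the chain sum produces a single correction term.\<close>

lemma level_sum_poly_Suc:
  "level_sum_poly r (Suc s) p = level_sum_poly r s p + (if s = 0 then of_nat r * cd_rec r p else 0)"
  by (simp add: level_sum_poly_def algebra_simps mult_2)

text \<open>The chain recursion for a source that is not small, as an identity of polynomials.
  Splitting off \<open>s = 0\<close> and factoring out \<open>a - b\<close> leaves the previous
  instance and the correction.\<close>

lemma cd_rec_chain:
  "cd_rec r (Suc k) = (ab_a - ab_b) ^ k +
     (\<Sum>s<k. (ab_a - ab_b) ^ s * ab_b * level_sum_poly r s (k - s))"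
proof (induction k)
  case 0
  then show ?case by simp
next
  case (Suc k)
  let ?t = "ab_a - ab_b" and ?P = "cd_rec r"
  have com: "x * (of_nat r * y) = of_nat r * (x * y)" for x y :: "ab_letter ncpoly"
    by (metis mult.assoc mult_of_nat_commute)
  have com2: "x * (2 * y) = 2 * (x * y)" for x y :: "ab_letter ncpoly"
    by (simp add: mult_2 distrib_left)
  let ?S = "\<Sum>s<k. ?t ^ s * ab_b * level_sum_poly r s (k - s)"
  let ?C = "\<Sum>s<k. ?t ^ s * ab_b * (if s = 0 then of_nat r * ?P (k - s) else 0)"
  \<comment> \<open>For \<open>k = 0\<close> the sum is empty, in agreement with
    \<open>cd_rec r 0 = 0\<close>.\<close>
  have C: "?C = of_nat r * (ab_b * ?P k)"
    by (cases k) (simp_all add: sum.lessThan_Suc_shift com del: sum.lessThan_Suc cd_rec.simps(2))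
  have "(\<Sum>s<Suc k. ?t ^ s * ab_b * level_sum_poly r s (Suc k - s)) =
      ab_b * level_sum_poly r 0 (Suc k) + (\<Sum>s<k. ?t ^ Suc s * ab_b * level_sum_poly r (Suc s) (k - s))"
    by (subst sum.lessThan_Suc_shift) simp
  also have "(\<Sum>s<k. ?t ^ Suc s * ab_b * level_sum_poly r (Suc s) (k - s)) = ?t * (?S + ?C)"
    by (simp add: level_sum_poly_Suc sum_distrib_left mult.assoc distrib_left flip: sum.distrib)
  also have "?S = ?P (Suc k) - ?t ^ k"
    using Suc.IH by simp
  finally have "?t ^ Suc k + (\<Sum>s<Suc k. ?t ^ s * ab_b * level_sum_poly r s (Suc k - s)) =
      ab_b * level_sum_poly r 0 (Suc k) + ?t * (?P (Suc k) + of_nat r * (ab_b * ?P k))"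
    unfolding C by (simp add: algebra_simps)
  \<comment> \<open>This uses \<open>2 b + (a - b) = c\<close> and
    \<open>b c + (a - b) b = d\<close>.\<close>
  also have "\<dots> = ?P (Suc (Suc k))"
    by (simp add: level_sum_poly_def com com2 algebra_simps mult_2)
  finally show ?case by simp
qed

text \<open>Above a small source come two elements that are not small; later levels are those of an
  ordinary source shifted by one. The sum becomes \<open>(2 b + (a - b)) P\<close>, that is
  \<open>c P\<close>.\<close>

lemma cd_rec_chain_small:
  "cd_in_ab Let_c * cd_rec r (Suc k) = (ab_a - ab_b) ^ Suc k +
     (\<Sum>s<Suc k. (ab_a - ab_b) ^ s * ab_b *
       (if s = 0 then 2 * cd_rec r (Suc k) else level_sum_poly r (s - 1) (Suc k - s)))"
proof -
  let ?t = "ab_a - ab_b"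
  have com2: "x * (2 * y) = 2 * (x * y)" for x y :: "ab_letter ncpoly"
    by (simp add: mult_2 distrib_left)
  have "(\<Sum>s<Suc k. ?t ^ s * ab_b *
       (if s = 0 then 2 * cd_rec r (Suc k) else level_sum_poly r (s - 1) (Suc k - s))) =
     ab_b * (2 * cd_rec r (Suc k)) + ?t * (\<Sum>s<k. ?t ^ s * ab_b * level_sum_poly r s (k - s))"
    by (subst sum.lessThan_Suc_shift) (simp add: sum_distrib_left mult.assoc)
  also have "(\<Sum>s<k. ?t ^ s * ab_b * level_sum_poly r s (k - s)) = cd_rec r (Suc k) - ?t ^ k"
    using cd_rec_chain[of r k] by simp
  finally show ?thesis by (simp add: com2 algebra_simps mult_2)
qed

section \<open>The \<open>ab\<close>-index of level intervals\<close>

lemma chains_between_level_interval: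
  assumes "(x, y) \<in> level_order (mat_M r)"
  shows "chains_between (level_interval_order (mat_M r) x y) x y = chains_between (level_order (mat_M r)) x y"
  unfolding level_interval_order_def level_interval_def
  using assms by (intro chains_between_Restr level_order_trans)
    (auto simp: level_order_def)

lemma finite_chains_level_order: "finite (chains_between (level_order (mat_M r)) x y)"
proof (cases "(x, y) \<in> level_order (mat_M r)")
  case True
  then show ?thesis
    using finite_chains_between[OF graded_level_interval] by (simp add: chains_between_level_interval)
next
  case False
  then have "chains_between (level_order (mat_M r)) x y = {}"
    by (auto simp: chains_between_def)
  then show ?thesis by simp
qed

lemma ab_index_level_rec:
  assumes ij: "i < 2 * r + 2" "j < 2 * r + 2" and re: "M_reach r (Suc k) i j"
  shows "ab_index (level_order (mat_M r)) snd (i, a) (j, a + int (Suc k)) =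
    (ab_a - ab_b) ^ k + (\<Sum>s<k. (ab_a - ab_b) ^ s * ab_b *
      (\<Sum>m\<in>lev r i j (Suc k) (Suc s).
         ab_index (level_order (mat_M r)) snd (m, a + int (Suc s)) (j, a + int (Suc k))))"
proof -
  let ?L = "level_order (mat_M r)"
  let ?x = "(i, a)" and ?y = "(j, a + int (Suc k))"
  let ?g = "\<lambda>z. (ab_a - ab_b) ^ nat (snd z - snd ?x - 1) * ab_b * ab_index ?L snd z ?y"
  have xy: "(?x, ?y) \<in> ?L" using assms by (simp add: level_order_M nat_add_distrib)
  have ne: "?x \<noteq> ?y" by simp
  have fin: "finite (interval ?L ?x ?y)"
    using finite_level_interval[of "mat_M r" ?x ?y] by (simp add: level_interval_def)
  have mem: "?x \<in> interval ?L ?x ?y" "?y \<in> interval ?L ?x ?y"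
    using xy by (auto simp: interval_def level_order_def)
  have "ab_index ?L snd ?x ?y = (ab_a - ab_b) ^ nat (snd ?y - snd ?x - 1) +
      (\<Sum>z\<in>interval ?L ?x ?y - {?x, ?y}. ?g z)"
    by (rule ab_index_rec[OF level_order_trans level_order_antisym xy ne fin finite_chains_level_order])
  \<comment> \<open>The end terms are added so that \<open>sum_level_interval\<close> applies; they
    cancel again, whatever the truncated exponent at \<open>?x\<close> yields.\<close>
  also have "(\<Sum>z\<in>interval ?L ?x ?y - {?x, ?y}. ?g z) =
      (\<Sum>z\<in>interval ?L ?x ?y. ?g z) - (?g ?x + ?g ?y)"
    using fin mem by (subst sum_diff) auto
  also have "(\<Sum>z\<in>interval ?L ?x ?y. ?g z) =
      (\<Sum>s\<le>Suc k. \<Sum>m\<in>lev r i j (Suc k) s. ?g (m, a + int s))"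
    by (rule sum_level_interval[OF ij])
  also have "\<dots> = ?g ?x + ?g ?y + (\<Sum>s<k. \<Sum>m\<in>lev r i j (Suc k) (Suc s). ?g (m, a + int (Suc s)))"
  proof -
    have "(\<Sum>s\<le>Suc k. h s) = h 0 + h (Suc k) + (\<Sum>s<k. h (Suc s))" for h :: "nat \<Rightarrow> ab_letter ncpoly"
      by (induction k) (simp_all add: ac_simps)
    then show ?thesis using lev_ends[OF ij re] by simp
  qed
  finally show ?thesis
    by (simp add: sum_distrib_left)
qed

text \<open>The parameter \<open>k\<close> is one less than the rank of the interval.\<close>

definition level_poly :: "nat \<Rightarrow> nat \<Rightarrow> nat \<Rightarrow> ab_letter ncpoly" where
  "level_poly r i k = (if k = 0 then 1 else if small_src r i
     then cd_in_ab Let_c * cd_rec r k else cd_rec r (Suc k))"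

lemma sum_level_poly:
  assumes "finite S"
  shows "(\<Sum>m\<in>S. level_poly r m (Suc k)) =
    of_nat (card {m\<in>S. \<not> small_src r m}) * cd_rec r (Suc (Suc k)) +
    of_nat (card {m\<in>S. small_src r m}) * (cd_in_ab Let_c * cd_rec r (Suc k))"
  unfolding level_poly_def using assms
  by (simp add: sum.If_cases Int_def add.commute del: cd_rec.simps cd_in_ab.simps)

text \<open>Only the numbers of small and other elements on a level matter. The level just below the
  target is separate: there all indices are \<open>1\<close> and the target restricts the
  level.\<close>

lemma sum_lev:
  assumes ij: "i < 2 * r + 2" "j < 2 * r + 2" and j: "\<not> small_tgt r j"
    and re: "M_reach r (Suc k) i j" and s: "s < k"
  shows "(\<Sum>m\<in>lev r i j (Suc k) (Suc s). level_poly r m (k - Suc s)) =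
    (if \<not> small_src r i then level_sum_poly r s (k - s)
     else if s = 0 then 2 * cd_rec r k else level_sum_poly r (s - 1) (k - s))"
proof (cases "k = Suc s")
  case True
  have "(\<Sum>m\<in>lev r i j (Suc k) (Suc s). level_poly r m (k - Suc s)) =
      of_nat (card (lev r i j (Suc k) (Suc s)))"
    by (simp add: True level_poly_def)
  also have "card (lev r i j (Suc k) (Suc s)) =
      (if s = 0 then 2 else if small_src r i \<and> s = 1 then 2 else r + 2)"
  proof -
    consider "s = 0" | "s = 1" | "s \<ge> 2" by linarith
    then show ?thesis
    proof cases
      case 1
      then show ?thesis using card_diamond[OF ij] j by (simp add: lev_def True M_reach_simps)
    next
      case 2
      then show ?thesis
        using card_reach2_edge[OF ij] j
        by (simp add: lev_def True M_reach_simps flip: numeral_2_eq_2)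
    next
      case 3
      then show ?thesis using card_edges_to[OF ij(2)] j by (simp add: lev_def True M_reach_simps)
    qed
  qed
  \<comment> \<open>Here \<open>k - s = 1\<close>, so \<open>cd_rec r 0 = 0\<close> removes the
    second summand of \<open>level_sum_poly\<close>.\<close>
  finally show ?thesis by (auto simp: True level_sum_poly_def)
next
  case False
  then obtain p where p: "k = Suc (Suc (s + p))"
    using s by (metis add_Suc_right less_natE less_antisym not_less_eq add_Suc_shift Suc_lessI)
  let ?S = "lev r i j (Suc k) (Suc s)"
  \<comment> \<open>At least two steps remain, and a target that is not small is then always
    reachable.\<close>
  have S: "?S = {m. m < 2 * r + 2 \<and> M_reach r (Suc s) i m}"
    using j by (auto simp: lev_def p intro!: M_reach_ge2)
  have cards: "card {m\<in>?S. \<not> small_src r m} = (if s = 0 \<or> small_src r i \<and> s = 1 then 2 else r + 2)"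
    "card {m\<in>?S. small_src r m} = (if small_src r i \<and> s = 0 then 0 else r)"
  proof -
    consider "s = 0" | "s = 1" | "s \<ge> 2" by linarith
    then have "card {m\<in>?S. \<not> small_src r m} = (if s = 0 \<or> small_src r i \<and> s = 1 then 2 else r + 2)
      \<and> card {m\<in>?S. small_src r m} = (if small_src r i \<and> s = 0 then 0 else r)"
    proof cases
      case 1
      have S0: "?S = {m. m < 2 * r + 2 \<and> M_edge r i m}"
        unfolding S by (simp add: 1 M_reach_simps)
      have part: "{m\<in>?S. P m} = {m. m < 2 * r + 2 \<and> M_edge r i m} \<inter> {m. P m}" for P
        unfolding S0 by auto
      have "{m\<in>?S. \<not> small_src r m} =
          (if small_src r i then {i + r, i + r + 1} else if i = 0 then {0, r + 1} else {0, 2 * r + 1})"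
        "{m\<in>?S. small_src r m} = (if small_src r i then {} else {1..r})"
        unfolding part edges_from[OF ij(1)] by (auto simp: small_src_def)
      then show ?thesis using 1 by simp
    next
      case 2
      \<comment> \<open>Two steps above a small source the small columns are missing, which leaves
        \<open>0\<close> and \<open>2 * r + 1\<close> besides the small rows.\<close>
      have eqs: "{m\<in>?S. \<not> small_src r m} =
          {m. m < 2 * r + 2 \<and> \<not> small_src r m \<and> (small_src r i \<longrightarrow> \<not> small_tgt r m)}"
        "{m\<in>?S. small_src r m} = {m. m < 2 * r + 2 \<and> small_src r m}"
        unfolding S using 2 by (auto simp: M_reach_simps small_src_def small_tgt_def simp flip: numeral_2_eq_2)
      show ?thesis
        unfolding eqs using 2 card_not_small_src[of r] card_not_small_src_tgt[of r] card_small_src[of r]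
        by (cases "small_src r i") simp_all
    next
      case 3
      then show ?thesis
        using card_not_small_src[of r] card_small_src[of r] by (simp add: S M_reach_simps)
    qed
    then show "card {m\<in>?S. \<not> small_src r m} = (if s = 0 \<or> small_src r i \<and> s = 1 then 2 else r + 2)"
      "card {m\<in>?S. small_src r m} = (if small_src r i \<and> s = 0 then 0 else r)" by auto
  qed
  have "finite ?S" by (simp add: S)
  then show ?thesis
    using sum_level_poly[of ?S r p] cards by (auto simp: p level_sum_poly_def simp del: cd_rec.simps cd_in_ab.simps)
qed

text \<open>Strong induction on the rank with the target fixed; source and level vary because inner
  elements become new sources.\<close>

lemma ab_index_level:
  assumes ij: "i < 2 * r + 2" "j < 2 * r + 2" and j: "\<not> small_tgt r j"
    and "M_reach r (Suc k) i j"
  shows "ab_index (level_order (mat_M r)) snd (i, a) (j, a + int (Suc k)) = level_poly r i k"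
  using ij(1) assms(4)
proof (induction k arbitrary: i a rule: less_induct)
  case (less k)
  note ij = less.prems(1) \<open>j < 2 * r + 2\<close>
  have "ab_index (level_order (mat_M r)) snd (m, a + int (Suc s)) (j, a + int (Suc k)) =
      level_poly r m (k - Suc s)"
    if "s < k" "m \<in> lev r i j (Suc k) (Suc s)" for s m
  proof -
    have "Suc k - Suc s = Suc (k - Suc s)" using that(1) by simp
    then have "m < 2 * r + 2" "M_reach r (Suc (k - Suc s)) m j"
      using that(2) by (auto simp: lev_def)
    moreover have "a + int (Suc s) + int (Suc (k - Suc s)) = a + int (Suc k)" using that(1) by simp
    ultimately show ?thesis using less.IH[of "k - Suc s" m "a + int (Suc s)"] that(1) by simp
  qed
  then have "ab_index (level_order (mat_M r)) snd (i, a) (j, a + int (Suc k)) =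
    (ab_a - ab_b) ^ k + (\<Sum>s<k. (ab_a - ab_b) ^ s * ab_b *
      (\<Sum>m\<in>lev r i j (Suc k) (Suc s). level_poly r m (k - Suc s)))"
    unfolding ab_index_level_rec[OF ij less.prems(2)]
    by (intro arg_cong2[of _ _ _ _ "(+)"] arg_cong2[of _ _ _ _ "(*)"] sum.cong refl) auto
  also have "\<dots> = (ab_a - ab_b) ^ k + (\<Sum>s<k. (ab_a - ab_b) ^ s * ab_b *
      (if \<not> small_src r i then level_sum_poly r s (k - s)
       else if s = 0 then 2 * cd_rec r k else level_sum_poly r (s - 1) (k - s)))"
    by (simp add: sum_lev[OF ij j less.prems(2)])
  also have "\<dots> = level_poly r i k"
  proof (cases "small_src r i")
    case True
    then show ?thesis
    proof (cases k)
      case 0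
      then show ?thesis by (simp add: level_poly_def)
    next
      case (Suc l)
      then show ?thesis
        using True by (simp only: level_poly_def cd_rec_chain_small) simp
    qed
  next
    case False
    have "level_poly r i k = cd_rec r (Suc k)"
      using False by (auto simp: level_poly_def)
    then show ?thesis using False cd_rec_chain[of r k] by simp
  qed
  finally show ?case .
qed

theorem corollary4p4:
  fixes r k i j :: nat
  assumes "i \<in> {0} \<union> {r + 1..2 * r + 1}"
    and "j \<in> {0..r} \<union> {2 * r + 1}"
    and "(i, j) = (0, 2 * r + 1) \<longrightarrow> k \<ge> 1"
  shows "is_cd_index
           (level_interval (mat_M r) (i, 0) (j, int k + 1))
           (level_interval_order (mat_M r) (i, 0) (j, int k + 1))
           snd (i, 0) (j, int k + 1)
           (\<Sum>w | cd_degree w = k. of_nat r ^ count_list w Let_d * ncmono w)"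
proof -
  have ij: "i < 2 * r + 2" "j < 2 * r + 2" and i: "\<not> small_src r i" and j: "\<not> small_tgt r j"
    using assms by (auto simp: small_src_def small_tgt_def)
  have re: "M_reach r (Suc k) i j"
  proof (cases "k = 0")
    case True
    then show ?thesis using assms by (auto simp: M_reach_simps M_edge_def)
  next
    case False
    then show ?thesis using i by (intro M_reach_ge2) auto
  qed
  have xy: "((i, 0), (j, int k + 1)) \<in> level_order (mat_M r)"
    using ij re by (simp add: level_order_M nat_add_distrib)
  have "ab_index (level_order (mat_M r)) snd (i, 0) (j, int k + 1) = cd_rec r (Suc k)"
  proof -
    have "0 + int (Suc k) = int k + 1" by simp
    moreover have "level_poly r i k = cd_rec r (Suc k)"
      using i by (cases k) (simp_all add: level_poly_def)
    ultimately show ?thesis using ab_index_level[OF ij j re, of 0] by (simp only:)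
  qed
  then show ?thesis
    unfolding is_cd_index_def ncsubst_cd_sum
    using Eulerian_level_interval[OF xy] chains_between_level_interval[OF xy] by (simp add: ab_index_def)
qed

end
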